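(* Let $K$ and $L$ be finite simplicial complexes and let $f\colon K\to L$ be a non-degenerate simplicial map such that $|f|\colon |K|\to |L|$ lifts to an embedding. Then the following holds: (1) all the covering maps $p_n\colon |K^{(n)}_f|\to |\widetilde{K}^{(n)}_f|$, $n>1$, are trivial; (2) there are no $n$-obstructors for $f$ for any $n>1$.
   Context: $|K|$ denotes the geometric realisation of a simplicial complex $K$, and $|f|\colon|K|\to|L|$ is the piecewise linear map induced by a simplicial map $f\colon K\to L$. A piecewise linear map is non-degenerate if all preimages of points are finite sets; a simplicial map $f$ is non-degenerate if $|f|$ is, which for finite complexes is equivalent to $f$ being injective on each simplex (a $k$-simplex maps to a $k$-simplex). A piecewise linear map $\varphi\colon P\to Q$ of polyhedra lifts to an embedding if there is a piecewise linear embedding $\widetilde{\varphi}\colon P\to Q\times\mathbb{R}$ with $\varphi=\mathrm{pr}_Q\circ\widetilde{\varphi}$. For a non-degenerate simplicial map $f\colon K\to L$, $K^{(n)}_f$ is the simplicial complex whose vertices are $n$-tuples of distinct vertices of $K$ that are mapped to the same vertex by $f$; a set $\{(v_1^1,\dots,v_n^1),\dots,(v_1^{k+1},\dots,v_n^{k+1})\}$ of $k+1$ vertices forms a $k$-simplex if for each $j=1,\dots,n$ the set $\{v_j^1,\dots,v_j^{k+1}\}$ forms a $k$-simplex of $K$. The symmetric group $S_n$ acts on $K^{(n)}_f$ by permuting entries of tuples; $\widetilde{K}^{(n)}_f=K^{(n)}_f/S_n$, and $p_n\colon|K^{(n)}_f|\to|\widetilde{K}^{(n)}_f|$ is the induced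 covering map, which is a principal $S_n$-bundle. "Trivial" means trivial as a principal $S_n$-bundle (equivalently, admitting a continuous section). An $n$-obstructor for $f$ is a vertex $(x_1,x_2,\dots,x_n)\in K^{(n)}_f$ together with a path in $K^{(n)}_f$ from $(x_1,x_2,\dots,x_n)$ to $(x_n,x_1,x_2,\dots,x_{n-1})$. *)

theory Defs
  imports "HOL-Analysis.Analysis" "HOL-Analysis.Finite_Function_Topology"
    "HOL-Combinatorics.Permutations"
begin

section \<open>Finite simplicial complexes and their geometric realisations\<close>

text \<open>Complexes are abstract: sets of nonempty finite vertex sets, closed under nonempty subsets.\<close>

definition finite_complex :: "'a set set \<Rightarrow> bool" where
  "finite_complex K \<longleftrightarrow> finite K \<and> (\<forall>\<sigma>\<in>K. finite \<sigma> \<and> \<sigma> \<noteq> {}) \<and>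
     (\<forall>\<sigma>\<in>K. \<forall>\<tau>. \<tau> \<subseteq> \<sigma> \<and> \<tau> \<noteq> {} \<longrightarrow> \<tau> \<in> K)"

text \<open>The realisation lives in the normed space of finitely supported real functions on the
  vertices (barycentric coordinates). For a finite complex the subspace topology is the usual
  topology of the realisation.\<close>

definition pt :: "'a \<Rightarrow> 'a \<Rightarrow>\<^sub>0 real" where
  "pt v = Poly_Mapping.single v 1"

definition realisation :: "'a set set \<Rightarrow> ('a \<Rightarrow>\<^sub>0 real) set" where
  "realisation K = (\<Union>\<sigma>\<in>K. convex hull (pt ` \<sigma>))"

definition simplicial_map :: "'a set set \<Rightarrow> 'b set set \<Rightarrow> ('a \<Rightarrow> 'b) \<Rightarrow> bool" where
  "simplicial_map K L f \<longleftrightarrow> (\<forall>\<sigma>\<in>K. f ` \<sigma> \<in> L)"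

definition realisation_map :: "('a \<Rightarrow> 'b) \<Rightarrow> ('a \<Rightarrow>\<^sub>0 real) \<Rightarrow> ('b \<Rightarrow>\<^sub>0 real)" where
  "realisation_map f x = (\<Sum>v\<in>Poly_Mapping.keys x. Poly_Mapping.lookup x v *\<^sub>R pt (f v))"

section \<open>Piecewise linear maps, non-degeneracy, lifting to an embedding\<close>

text \<open>The library's notion of triangulation is restricted to Euclidean spaces.
  The intersection condition is symmetric in \<open>S\<close> and \<open>T\<close>, so intersections are common faces;
  closure under faces is not required, since adding all faces changes nothing below.\<close>

definition triangulates :: "'v::real_vector set set \<Rightarrow> 'v set \<Rightarrow> bool" where
  "triangulates \<T> P \<longleftrightarrow> finite \<T> \<and> \<Union>\<T> = P \<and>
     (\<forall>T\<in>\<T>. \<exists>C. finite C \<and> \<not> affine_dependent C \<and> T = convex hull C) \<and>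
     (\<forall>S\<in>\<T>. \<forall>T\<in>\<T>. (S \<inter> T) face_of S)"

definition piecewise_linear_on ::
    "'v::real_vector set \<Rightarrow> ('v \<Rightarrow> 'w::real_vector) \<Rightarrow> bool" where
  "piecewise_linear_on P g \<longleftrightarrow> (\<exists>\<T>. triangulates \<T> P \<and>
     (\<forall>T\<in>\<T>. \<forall>x\<in>T. \<forall>y\<in>T. \<forall>u\<in>{0..1}.
        g ((1 - u) *\<^sub>R x + u *\<^sub>R y) = (1 - u) *\<^sub>R g x + u *\<^sub>R g y))"

definition pl_embedding_on ::
    "'v::real_normed_vector set \<Rightarrow> ('v \<Rightarrow> 'w::real_normed_vector) \<Rightarrow> bool" where
  "pl_embedding_on P g \<longleftrightarrow> piecewise_linear_on P g \<and> (\<exists>h. homeomorphism P (g ` P) g h)"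

definition nondegenerate_on :: "'v set \<Rightarrow> ('v \<Rightarrow> 'w) \<Rightarrow> bool" where
  "nondegenerate_on P \<phi> \<longleftrightarrow> (\<forall>y. finite {x \<in> P. \<phi> x = y})"

definition nondegenerate_simplicial_map :: "'a set set \<Rightarrow> 'b set set \<Rightarrow> ('a \<Rightarrow> 'b) \<Rightarrow> bool" where
  "nondegenerate_simplicial_map K L f \<longleftrightarrow>
     simplicial_map K L f \<and> nondegenerate_on (realisation K) (realisation_map f)"

definition lifts_to_embedding ::
    "'v::real_normed_vector set \<Rightarrow> 'w::real_normed_vector set \<Rightarrow> ('v \<Rightarrow> 'w) \<Rightarrow> bool" where
  "lifts_to_embedding P Q \<phi> \<longleftrightarrow> (\<exists>\<psi> :: 'v \<Rightarrow> 'w \<times> real.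
     pl_embedding_on P \<psi> \<and> \<psi> ` P \<subseteq> Q \<times> UNIV \<and> (\<forall>x\<in>P. fst (\<psi> x) = \<phi> x))"

section \<open>The complex of n-tuples in the fibres of f\<close>

definition fibre_tuples :: "'a set set \<Rightarrow> ('a \<Rightarrow> 'b) \<Rightarrow> nat \<Rightarrow> 'a list set" where
  "fibre_tuples K f n = {xs. length xs = n \<and> distinct xs \<and> set xs \<subseteq> \<Union>K \<and>
     (\<forall>x\<in>set xs. \<forall>y\<in>set xs. f x = f y)}"

text \<open>The cardinality condition says that the entries at each position \<open>j\<close> span a simplex of the
  same dimension as \<open>S\<close>.\<close>

definition tuple_complex :: "'a set set \<Rightarrow> ('a \<Rightarrow> 'b) \<Rightarrow> nat \<Rightarrow> 'a list set set" where
  "tuple_complex K f n = {S. finite S \<and> S \<noteq> {} \<and> S \<subseteq> fibre_tuples K f n \<and>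
     (\<forall>j<n. (\<lambda>xs. xs ! j) ` S \<in> K \<and> card ((\<lambda>xs. xs ! j) ` S) = card S)}"

definition tuple_space :: "'a set set \<Rightarrow> ('a \<Rightarrow> 'b) \<Rightarrow> nat \<Rightarrow> ('a list \<Rightarrow>\<^sub>0 real) topology" where
  "tuple_space K f n = top_of_set (realisation (tuple_complex K f n))"

section \<open>The action of the symmetric group and the orbit map\<close>

text \<open>The symmetric group is realised as the permutations of \<open>{..<n}\<close> under composition.
  Since \<open>permute_list (\<pi> \<circ> \<rho>) xs = permute_list \<rho> (permute_list \<pi> xs)\<close>, this is a right action.\<close>

definition sym_perms :: "nat \<Rightarrow> (nat \<Rightarrow> nat) set" where
  "sym_perms n = {\<pi>. \<pi> permutes {..<n}}"

definition sym_act :: "('a list \<Rightarrow>\<^sub>0 real) \<Rightarrow> (nat \<Rightarrow> nat) \<Rightarrow> ('a list \<Rightarrow>\<^sub>0 real)" where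
  "sym_act x \<pi> = realisation_map (permute_list \<pi>) x"

definition orbit_map :: "nat \<Rightarrow> ('a list \<Rightarrow>\<^sub>0 real) \<Rightarrow> ('a list \<Rightarrow>\<^sub>0 real) set" where
  "orbit_map n x = sym_act x ` sym_perms n"

definition quotient_topology :: "'x topology \<Rightarrow> ('x \<Rightarrow> 'y) \<Rightarrow> 'y topology" where
  "quotient_topology X q =
     topology (\<lambda>U. U \<subseteq> q ` topspace X \<and> openin X {x \<in> topspace X. q x \<in> U})"

lemma openin_quotient_topology:
  "openin (quotient_topology X q) U \<longleftrightarrow>
     U \<subseteq> q ` topspace X \<and> openin X {x \<in> topspace X. q x \<in> U}"
proof -
  have int: "{x \<in> topspace X. q x \<in> S \<inter> T} =
      {x \<in> topspace X. q x \<in> S} \<inter> {x \<in> topspace X. q x \<in> T}" for S T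
    by auto
  have un: "{x \<in> topspace X. q x \<in> \<Union>\<U>} = (\<Union>U\<in>\<U>. {x \<in> topspace X. q x \<in> U})" for \<U>
    by auto
  have "istopology (\<lambda>U. U \<subseteq> q ` topspace X \<and> openin X {x \<in> topspace X. q x \<in> U})"
    unfolding istopology_def int un by (auto intro!: openin_Union)
  then show ?thesis
    by (simp add: quotient_topology_def topology_inverse')
qed

lemma topspace_quotient_topology: "topspace (quotient_topology X q) = q ` topspace X"
proof -
  have "{x \<in> topspace X. q x \<in> q ` topspace X} = topspace X"
    by auto
  then have "openin (quotient_topology X q) (q ` topspace X)"
    by (simp add: openin_quotient_topology)
  then show ?thesis
    using openin_subset openin_topspace openin_quotient_topology by (metis subset_antisym)
qed

lemma quotient_map_quotient_topology: "quotient_map X (quotient_topology X q) q"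
  by (auto simp: quotient_map_def topspace_quotient_topology openin_quotient_topology)

text \<open>The quotient of the tuple complex is taken on the level of spaces. In general two simplices
  in different orbits can have the same vertex orbits, so the simplices of the quotient are not
  determined by their vertex sets and it is not an abstract simplicial complex.\<close>

definition orbit_space ::
    "'a set set \<Rightarrow> ('a \<Rightarrow> 'b) \<Rightarrow> nat \<Rightarrow> ('a list \<Rightarrow>\<^sub>0 real) set topology" where
  "orbit_space K f n = quotient_topology (tuple_space K f n) (orbit_map n)"

text \<open>Triviality of a principal bundle \<open>p : E \<rightarrow> B\<close> for a discrete group with carrier \<open>G\<close> and
  multiplication \<open>m\<close> acting on \<open>E\<close> from the right: an equivariant homeomorphism over \<open>B\<close> from
  \<open>E\<close> to \<open>B \<times> G\<close>.\<close>

definition trivial_principal_bundle ::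
    "'g set \<Rightarrow> ('g \<Rightarrow> 'g \<Rightarrow> 'g) \<Rightarrow> ('e \<Rightarrow> 'g \<Rightarrow> 'e) \<Rightarrow> 'e topology \<Rightarrow> 'c topology \<Rightarrow>
      ('e \<Rightarrow> 'c) \<Rightarrow> bool" where
  "trivial_principal_bundle G m act E B p \<longleftrightarrow>
     (\<exists>t. homeomorphic_map E (prod_topology B (discrete_topology G)) (\<lambda>e. (p e, t e)) \<and>
          (\<forall>e\<in>topspace E. \<forall>g\<in>G. p (act e g) = p e \<and> t (act e g) = m (t e) g))"

definition trivial_covering :: "'a set set \<Rightarrow> ('a \<Rightarrow> 'b) \<Rightarrow> nat \<Rightarrow> bool" where
  "trivial_covering K f n \<longleftrightarrow>
     trivial_principal_bundle (sym_perms n) (\<circ>) sym_act (tuple_space K f n) (orbit_space K f n)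
       (orbit_map n)"

section \<open>Obstructors\<close>

definition obstructor ::
    "'a set set \<Rightarrow> ('a \<Rightarrow> 'b) \<Rightarrow> nat \<Rightarrow> 'a list \<Rightarrow> (real \<Rightarrow> 'a list \<Rightarrow>\<^sub>0 real) \<Rightarrow> bool" where
  "obstructor K f n xs \<gamma> \<longleftrightarrow> {xs} \<in> tuple_complex K f n \<and>
     path \<gamma> \<and> path_image \<gamma> \<subseteq> realisation (tuple_complex K f n) \<and>
     pathstart \<gamma> = pt xs \<and> pathfinish \<gamma> = pt (last xs # butlast xs)"

end

theory Submission
  imports Defs
begin

text \<open>A lift of \<open>|f|\<close> to an embedding in \<open>|L| \<times> \<real>\<close> has a second component, a continuous height
  function \<open>h\<close> on \<open>|K|\<close>, that separates the points of every fibre of \<open>|f|\<close>. A point \<open>z\<close> of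
  the complex of \<open>n\<close>-tuples has \<open>n\<close> coordinates in \<open>|K|\<close>, obtained by extending linearly the
  maps that send a tuple to its \<open>j\<close>-th entry. All of them lie in one fibre of \<open>|f|\<close>, and they are
  pairwise distinct (\<open>coordinate_distinct\<close>; this is where non-degeneracy enters), so their \<open>n\<close>
  heights are distinct reals. Let \<open>t z\<close> be the permutation that sends \<open>j\<close> to the rank of the
  \<open>j\<close>-th height. Distinct heights keep their order under small changes of \<open>z\<close>, so \<open>t\<close> is locally
  constant, and permuting the entries of the tuples permutes the heights in the same way, so
  \<open>t\<close> is equivariant (\<open>ranking_of_tuples\<close>).

  Both claims are formal consequences. A continuous equivariant map to the group, together with
  the orbit map, identifies the total space with the product of the orbit space and the group
  (\<open>trivial_principal_bundleI\<close>). Along a path \<open>t\<close> cannot change, whereas moving from a tuple to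
  its rotation composes \<open>t\<close> with a non-trivial cycle, so no path joins the two
  (\<open>lift_imp_no_obstructor\<close>).\<close>

section \<open>Linear extension of vertex maps\<close>

lemma lookup_scaleR [simp]:
  "Poly_Mapping.lookup (r *\<^sub>R x) v = r *\<^sub>R Poly_Mapping.lookup (x :: 'a \<Rightarrow>\<^sub>0 real) v"
proof -
  have "finite {v. r *\<^sub>R Poly_Mapping.lookup x v \<noteq> 0}"
    by (rule finite_subset[OF _ finite_keys[of x]]) (auto simp: in_keys_iff)
  then show ?thesis
    by (simp add: scaleR_poly_mapping_def)
qed

lemma lookup_pt: "Poly_Mapping.lookup (pt v) w = (if v = w then 1 else 0)"
  by (simp add: pt_def lookup_single when_def)

lemma realisation_map_eq_sum:
  assumes "finite A" "Poly_Mapping.keys x \<subseteq> A"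
  shows "realisation_map f x = (\<Sum>v\<in>A. Poly_Mapping.lookup x v *\<^sub>R pt (f v))"
  unfolding realisation_map_def
  by (rule sum.mono_neutral_left) (use assms in \<open>auto simp: in_keys_iff\<close>)

lemma linear_realisation_map: "linear (realisation_map f)"
proof (rule linearI)
  fix x y :: "'a \<Rightarrow>\<^sub>0 real" and r :: real
  let ?A = "Poly_Mapping.keys x \<union> Poly_Mapping.keys y"
  have "realisation_map f (x + y) = (\<Sum>v\<in>?A. Poly_Mapping.lookup (x + y) v *\<^sub>R pt (f v))"
    by (rule realisation_map_eq_sum) (auto simp: keys_add)
  also have "\<dots> = realisation_map f x + realisation_map f y"
    by (simp add: realisation_map_eq_sum[of ?A] lookup_add scaleR_left_distrib sum.distrib)
  finally show "realisation_map f (x + y) = realisation_map f x + realisation_map f y" .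
  have "realisation_map f (r *\<^sub>R x) =
      (\<Sum>v\<in>Poly_Mapping.keys x. Poly_Mapping.lookup (r *\<^sub>R x) v *\<^sub>R pt (f v))"
    by (rule realisation_map_eq_sum) (auto simp: in_keys_iff)
  then show "realisation_map f (r *\<^sub>R x) = r *\<^sub>R realisation_map f x"
    by (simp add: realisation_map_def scaleR_sum_right)
qed

lemma realisation_map_pt [simp]: "realisation_map f (pt v) = pt (f v)"
  by (simp add: realisation_map_def pt_def)

lemma realisation_map_comp:
  "realisation_map g (realisation_map f x) = realisation_map (g \<circ> f) x"
proof -
  interpret g: linear "realisation_map g"
    by (rule linear_realisation_map)
  have "realisation_map g (realisation_map f x) =
      (\<Sum>v\<in>Poly_Mapping.keys x. Poly_Mapping.lookup x v *\<^sub>R realisation_map g (pt (f v)))"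
    by (simp add: realisation_map_def[of f] g.sum g.scale)
  then show ?thesis
    by (simp add: realisation_map_def[of "g \<circ> f"])
qed

lemma realisation_map_cong:
  "(\<And>v. v \<in> Poly_Mapping.keys x \<Longrightarrow> f v = g v) \<Longrightarrow> realisation_map f x = realisation_map g x"
  unfolding realisation_map_def by (rule sum.cong) auto

lemma lookup_realisation_map:
  "Poly_Mapping.lookup (realisation_map f x) w =
     (\<Sum>v\<in>Poly_Mapping.keys x. if f v = w then Poly_Mapping.lookup x v else 0)"
  unfolding realisation_map_def lookup_sum
  by (rule sum.cong) (auto simp: lookup_pt)

lemma realisation_map_ident: "realisation_map (\<lambda>v. v) x = x"
  by (rule poly_mapping_eqI) (auto simp: lookup_realisation_map in_keys_iff)

text \<open>The norm is the sum of the absolute values of the coordinates, so pushing coordinates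
  forward can only decrease it, whatever the size of the complex.\<close>

lemma bounded_linear_realisation_map: "bounded_linear (realisation_map f)"
proof -
  interpret linear "realisation_map f"
    by (rule linear_realisation_map)
  have norm_pt: "norm (pt w) = 1" for w :: 'b
    by (simp add: norm_poly_mapping_def dist_poly_mapping_def pt_def)
  have "norm (realisation_map f x) \<le> norm x * 1" for x
  proof -
    have "norm (realisation_map f x) \<le>
        (\<Sum>v\<in>Poly_Mapping.keys x. norm (Poly_Mapping.lookup x v *\<^sub>R pt (f v)))"
      unfolding realisation_map_def by (rule norm_sum)
    also have "\<dots> = norm x"
      by (simp add: norm_pt) (simp add: norm_poly_mapping_def dist_poly_mapping_def)
    finally show ?thesis by simp
  qed
  then show ?thesis
    by (intro bounded_linear_intro[where K = 1]) (auto simp: add scale)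
qed

lemma continuous_on_realisation_map: "continuous_on U (realisation_map f)"
  by (rule linear_continuous_on[OF bounded_linear_realisation_map])

lemma simplicial_map_realisation:
  assumes "simplicial_map K L f" "x \<in> realisation K"
  shows "realisation_map f x \<in> realisation L"
proof -
  obtain \<sigma> where \<sigma>: "\<sigma> \<in> K" "x \<in> convex hull (pt ` \<sigma>)"
    using assms(2) by (auto simp: realisation_def)
  have "realisation_map f ` (convex hull (pt ` \<sigma>)) = convex hull (pt ` f ` \<sigma>)"
    by (simp add: convex_hull_linear_image[OF linear_realisation_map] image_image)
  moreover have "f ` \<sigma> \<in> L"
    using assms(1) \<sigma>(1) by (simp add: simplicial_map_def)
  ultimately show ?thesis
    using \<sigma>(2) by (auto simp: realisation_def)
qed

lemma convex_hull_pt: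
  assumes "finite \<sigma>" "x \<in> convex hull (pt ` \<sigma>)"
  shows "Poly_Mapping.keys x \<subseteq> \<sigma>" "Poly_Mapping.keys x \<noteq> {}"
proof -
  let ?P = "{x. (\<forall>v. v \<notin> \<sigma> \<longrightarrow> Poly_Mapping.lookup x v = 0) \<and>
    (\<Sum>v\<in>\<sigma>. Poly_Mapping.lookup x v) = (1::real)}"
  have "convex ?P"
    by (auto simp: convex_def lookup_add sum.distrib simp flip: sum_distrib_left)
  moreover have "pt ` \<sigma> \<subseteq> ?P"
    using assms(1) by (auto simp: lookup_pt)
  ultimately have "x \<in> ?P"
    using assms(2) hull_minimal by blast
  then show "Poly_Mapping.keys x \<subseteq> \<sigma>" "Poly_Mapping.keys x \<noteq> {}"
    by (auto simp: in_keys_iff)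
qed

text \<open>An edge collapsed by \<open>f\<close> would be a whole segment inside one fibre of the realised map.\<close>

lemma nondegenerate_inj_on_simplex:
  assumes "nondegenerate_simplicial_map K L f" "\<sigma> \<in> K"
  shows "inj_on f \<sigma>"
proof (rule inj_onI, rule ccontr)
  fix v w assume vw: "v \<in> \<sigma>" "w \<in> \<sigma>" "f v = f w" "v \<noteq> w"
  define e where "e u = (1 - u) *\<^sub>R pt v + u *\<^sub>R pt w" for u :: real
  interpret linear "realisation_map f"
    by (rule linear_realisation_map)
  have "e u \<in> {x \<in> realisation K. realisation_map f x = pt (f v)}" if "u \<in> {0..1}" for u
  proof -
    have "e u \<in> convex hull (pt ` \<sigma>)"
      unfolding e_def by (rule convexD_alt[OF convex_convex_hull]) (use vw that in \<open>auto intro: hull_inc\<close>)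
    moreover have "realisation_map f (e u) = pt (f v)"
      by (simp add: e_def add scale vw(3) flip: scaleR_left_distrib)
    ultimately show ?thesis
      using assms(2) by (auto simp: realisation_def)
  qed
  then have "e ` {0..1} \<subseteq> {x \<in> realisation K. realisation_map f x = pt (f v)}"
    by blast
  moreover have "finite {x \<in> realisation K. realisation_map f x = pt (f v)}"
    using assms(1) by (simp add: nondegenerate_simplicial_map_def nondegenerate_on_def)
  ultimately have "finite (e ` {0..1})"
    by (rule finite_subset)
  moreover have "inj e"
  proof (rule injI)
    fix a b assume "e a = e b"
    then have "Poly_Mapping.lookup (e a) w = Poly_Mapping.lookup (e b) w"
      by simp
    then show "a = b"
      using vw(4) by (simp add: e_def lookup_add lookup_pt)
  qed
  ultimately have "finite {0..1::real}"
    using finite_imageD inj_on_subset by blast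
  then show False
    by (simp add: infinite_Icc)
qed

section \<open>The points of the tuple complex\<close>

lemma simplicial_map_nth:
  "j < n \<Longrightarrow> simplicial_map (tuple_complex K f n) K (\<lambda>xs. xs ! j)"
  by (auto simp: simplicial_map_def tuple_complex_def)

lemma fibre_tuplesD:
  assumes "xs \<in> fibre_tuples K f n"
  shows "length xs = n" "distinct xs" "i < n \<Longrightarrow> j < n \<Longrightarrow> f (xs ! i) = f (xs ! j)"
  using assms unfolding fibre_tuples_def mem_Collect_eq by (blast intro: nth_mem)+

lemma fibre_tuples_permute:
  assumes "\<pi> permutes {..<n}" "xs \<in> fibre_tuples K f n"
  shows "permute_list \<pi> xs \<in> fibre_tuples K f n"
proof -
  have "\<pi> permutes {..<length xs}"
    using assms(1) fibre_tuplesD(1)[OF assms(2)] by simp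
  then have "set (permute_list \<pi> xs) = set xs" "distinct (permute_list \<pi> xs) = distinct xs"
    by simp_all
  then show ?thesis
    using assms(2) by (simp only: fibre_tuples_def mem_Collect_eq length_permute_list) blast
qed

lemma simplicial_map_permute:
  assumes "\<pi> permutes {..<n}"
  shows "simplicial_map (tuple_complex K f n) (tuple_complex K f n) (permute_list \<pi>)"
  unfolding simplicial_map_def
proof
  fix S assume S: "S \<in> tuple_complex K f n"
  have "(\<lambda>xs. xs ! j) ` permute_list \<pi> ` S \<in> K \<and>
      card ((\<lambda>xs. xs ! j) ` permute_list \<pi> ` S) = card (permute_list \<pi> ` S)" if "j < n" for j
  proof -
    have eq: "(\<lambda>xs. xs ! j) ` permute_list \<pi> ` S = (\<lambda>xs. xs ! \<pi> j) ` S"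
      unfolding image_image
      by (rule image_cong)
        (use S assms that in \<open>auto simp: tuple_complex_def dest!: fibre_tuplesD(1) subsetD
           intro!: permute_list_nth\<close>)
    have "\<pi> j < n"
      using permutes_in_image[OF assms] that by auto
    then have "(\<lambda>xs. xs ! \<pi> j) ` S \<in> K" "card ((\<lambda>xs. xs ! \<pi> j) ` S) = card S" and fin: "finite S"
      using S by (auto simp: tuple_complex_def)
    moreover have "card ((\<lambda>xs. xs ! j) ` permute_list \<pi> ` S) \<le> card (permute_list \<pi> ` S)"
      "card (permute_list \<pi> ` S) \<le> card S"
      using fin by (auto intro: card_image_le)
    ultimately show ?thesis
      by (simp add: eq)
  qed
  moreover have "permute_list \<pi> ` S \<subseteq> fibre_tuples K f n"
    using S fibre_tuples_permute[OF assms, of _ K f] by (auto simp: tuple_complex_def)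
  ultimately show "permute_list \<pi> ` S \<in> tuple_complex K f n"
    using S by (simp add: tuple_complex_def)
qed

lemma tuple_complex_keys:
  assumes "z \<in> realisation (tuple_complex K f n)"
  shows "Poly_Mapping.keys z \<subseteq> fibre_tuples K f n"
proof -
  obtain S where "S \<in> tuple_complex K f n" "z \<in> convex hull (pt ` S)"
    using assms by (auto simp: realisation_def)
  then show ?thesis
    using convex_hull_pt(1)[of S z] by (auto simp: tuple_complex_def)
qed

lemma sym_act_in:
  assumes "z \<in> realisation (tuple_complex K f n)" "\<pi> \<in> sym_perms n"
  shows "sym_act z \<pi> \<in> realisation (tuple_complex K f n)"
  using simplicial_map_realisation[OF simplicial_map_permute assms(1)] assms(2)
  by (simp add: sym_act_def sym_perms_def)

lemma sym_act_id: "sym_act (z :: 'a list \<Rightarrow>\<^sub>0 real) id = z"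
proof -
  have "permute_list id = (\<lambda>xs :: 'a list. xs)"
    by (rule ext) simp
  then show ?thesis
    by (simp only: sym_act_def realisation_map_ident)
qed

lemma sym_act_comp:
  assumes "z \<in> realisation (tuple_complex K f n)" "\<rho> \<in> sym_perms n"
  shows "sym_act (sym_act z \<pi>) \<rho> = sym_act z (\<pi> \<circ> \<rho>)"
  unfolding sym_act_def realisation_map_comp
proof (rule realisation_map_cong)
  fix xs assume "xs \<in> Poly_Mapping.keys z"
  then have "length xs = n"
    using tuple_complex_keys[OF assms(1)] by (auto dest: fibre_tuplesD(1))
  then show "(permute_list \<rho> \<circ> permute_list \<pi>) xs = permute_list (\<pi> \<circ> \<rho>) xs"
    using assms(2) by (simp add: sym_perms_def permute_list_compose)
qed

definition coordinate :: "nat \<Rightarrow> ('a list \<Rightarrow>\<^sub>0 real) \<Rightarrow> ('a \<Rightarrow>\<^sub>0 real)" where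
  "coordinate j = realisation_map (\<lambda>xs. xs ! j)"

lemma coordinate_in:
  "z \<in> realisation (tuple_complex K f n) \<Longrightarrow> j < n \<Longrightarrow> coordinate j z \<in> realisation K"
  unfolding coordinate_def by (rule simplicial_map_realisation[OF simplicial_map_nth])

lemma coordinate_sym_act:
  assumes "z \<in> realisation (tuple_complex K f n)" "\<pi> \<in> sym_perms n" "j < n"
  shows "coordinate j (sym_act z \<pi>) = coordinate (\<pi> j) z"
  unfolding sym_act_def coordinate_def realisation_map_comp
proof (rule realisation_map_cong)
  fix xs assume "xs \<in> Poly_Mapping.keys z"
  then have "length xs = n"
    using tuple_complex_keys[OF assms(1)] by (auto dest: fibre_tuplesD(1))
  then show "((\<lambda>xs. xs ! j) \<circ> permute_list \<pi>) xs = xs ! \<pi> j"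
    using assms(2,3) by (simp add: sym_perms_def permute_list_nth)
qed

lemma realisation_map_coordinate:
  assumes "z \<in> realisation (tuple_complex K f n)" "i < n" "j < n"
  shows "realisation_map f (coordinate i z) = realisation_map f (coordinate j z)"
  unfolding coordinate_def realisation_map_comp
proof (rule realisation_map_cong)
  fix xs assume "xs \<in> Poly_Mapping.keys z"
  then have "xs \<in> fibre_tuples K f n"
    using tuple_complex_keys[OF assms(1)] by auto
  then show "(f \<circ> (\<lambda>xs. xs ! i)) xs = (f \<circ> (\<lambda>xs. xs ! j)) xs"
    unfolding comp_def using assms(2,3) by (rule fibre_tuplesD(3))
qed

text \<open>Pick a tuple \<open>xs\<close> in the support of \<open>z\<close>. The weight of the vertex \<open>xs ! i\<close> in the
  \<open>i\<close>-th coordinate is exactly that of \<open>xs\<close> in \<open>z\<close>, since the positions of a simplex are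
  injective. If \<open>xs ! i\<close> occurred in the \<open>j\<close>-th coordinate as well, say as \<open>ys ! j\<close>, then
  \<open>xs ! j\<close> and \<open>ys ! j\<close> would be two vertices of one simplex with the same image under \<open>f\<close>;
  they agree by non-degeneracy, so that \<open>xs ! i = xs ! j\<close>, although tuples have
  distinct entries.\<close>

lemma coordinate_distinct:
  assumes inj: "\<And>\<sigma>. \<sigma> \<in> K \<Longrightarrow> inj_on f \<sigma>"
    and z: "z \<in> realisation (tuple_complex K f n)" and ij: "i < n" "j < n" "i \<noteq> j"
  shows "coordinate i z \<noteq> coordinate j z"
proof
  assume eq: "coordinate i z = coordinate j z"
  obtain S where S: "S \<in> tuple_complex K f n" "z \<in> convex hull (pt ` S)"
    using z by (auto simp: realisation_def)
  have fin: "finite S" and fib: "S \<subseteq> fibre_tuples K f n"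
    and K: "(\<lambda>xs. xs ! j) ` S \<in> K" and card: "card ((\<lambda>xs. xs ! i) ` S) = card S"
    using S(1) ij by (auto simp: tuple_complex_def)
  have keys: "Poly_Mapping.keys z \<subseteq> S"
    using convex_hull_pt(1)[OF fin S(2)] .
  obtain xs where xs: "xs \<in> Poly_Mapping.keys z"
    using convex_hull_pt(2)[OF fin S(2)] by blast
  have "ys ! i = xs ! i \<longleftrightarrow> ys = xs" if "ys \<in> Poly_Mapping.keys z" for ys
    using eq_card_imp_inj_on[OF fin card] that xs keys by (auto dest: inj_onD)
  then have "Poly_Mapping.lookup (coordinate i z) (xs ! i) =
      (\<Sum>ys\<in>Poly_Mapping.keys z. if ys = xs then Poly_Mapping.lookup z ys else 0)"
    unfolding coordinate_def lookup_realisation_map by (intro sum.cong) auto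
  also have "\<dots> \<noteq> 0"
    using xs by (simp add: in_keys_iff)
  finally have "Poly_Mapping.lookup (coordinate j z) (xs ! i) \<noteq> 0"
    by (simp add: eq)
  then obtain ys where ys: "ys \<in> Poly_Mapping.keys z" "ys ! j = xs ! i"
    unfolding coordinate_def lookup_realisation_map
    by (auto elim!: sum.not_neutral_contains_not_neutral split: if_splits)
  have tuple: "xs \<in> fibre_tuples K f n"
    using xs keys fib by auto
  then have "f (ys ! j) = f (xs ! j)"
    unfolding ys(2) using ij(1,2) by (rule fibre_tuplesD(3))
  then have "ys ! j = xs ! j"
    using inj_onD[OF inj[OF K]] xs ys(1) keys by blast
  with ys(2) ij fibre_tuplesD(1,2)[OF tuple] show False
    by (simp add: nth_eq_iff_index_eq)
qed

section \<open>Ranks of distinct heights\<close>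

text \<open>The value outside \<open>{..<n}\<close> makes this a permutation of all natural numbers with support in
  \<open>{..<n}\<close>, which is the form that the elements of \<open>sym_perms n\<close> have.\<close>

definition rank_perm :: "nat \<Rightarrow> (nat \<Rightarrow> real) \<Rightarrow> nat \<Rightarrow> nat" where
  "rank_perm n H j = (if j < n then card {i. i < n \<and> H i < H j} else j)"

lemma rank_perm_permutes:
  assumes "inj_on H {..<n}"
  shows "rank_perm n H permutes {..<n}"
proof (rule bij_imp_permutes)
  have less: "rank_perm n H i < rank_perm n H j" if "i < n" "j < n" "H i < H j" for i j
  proof -
    have "{k. k < n \<and> H k < H i} \<subset> {k. k < n \<and> H k < H j}"
      using that by auto
    then show ?thesis
      using that by (simp add: rank_perm_def psubset_card_mono)
  qed
  have inj: "inj_on (rank_perm n H) {..<n}"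
  proof (rule inj_onI)
    fix i j assume ij: "i \<in> {..<n}" "j \<in> {..<n}" "rank_perm n H i = rank_perm n H j"
    then have "H i = H j"
      using less[of i j] less[of j i] by (cases "H i" "H j" rule: linorder_cases) auto
    with assms ij show "i = j"
      by (auto dest: inj_onD)
  qed
  have "rank_perm n H j < n" if "j < n" for j
  proof -
    have "{i. i < n \<and> H i < H j} \<subset> {..<n}"
      using that by auto
    then show ?thesis
      using that psubset_card_mono[of "{..<n}"] by (simp add: rank_perm_def)
  qed
  then have "rank_perm n H ` {..<n} \<subseteq> {..<n}"
    by auto
  with inj show "bij_betw (rank_perm n H) {..<n} {..<n}"
    by (simp add: bij_betw_def endo_inj_surj)
qed (simp add: rank_perm_def)

lemma rank_perm_comp:
  assumes "\<pi> permutes {..<n}" "\<And>j. j < n \<Longrightarrow> H' j = H (\<pi> j)"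
  shows "rank_perm n H' = rank_perm n H \<circ> \<pi>"
proof
  fix j
  show "rank_perm n H' j = (rank_perm n H \<circ> \<pi>) j"
  proof (cases "j < n")
    case True
    have lt: "\<pi> i < n \<longleftrightarrow> i < n" for i
      using permutes_in_image[OF assms(1), of i] by simp
    have "{k. k < n \<and> H k < H (\<pi> j)} = \<pi> ` {i. i < n \<and> H' i < H' j}"
    proof (rule set_eqI)
      fix k
      obtain i where k: "k = \<pi> i"
        using permutes_surj[OF assms(1)] by (metis surjD)
      then show "k \<in> {k. k < n \<and> H k < H (\<pi> j)} \<longleftrightarrow> k \<in> \<pi> ` {i. i < n \<and> H' i < H' j}"
        using True assms(2) lt inj_image_mem_iff[OF permutes_inj[OF assms(1)]] by auto
    qed
    moreover have "card (\<pi> ` {i. i < n \<and> H' i < H' j}) = card {i. i < n \<and> H' i < H' j}"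
      using card_image[OF inj_on_subset[OF permutes_inj[OF assms(1)]]] by blast
    ultimately show ?thesis
      using True lt by (simp add: rank_perm_def)
  next
    case False
    then show ?thesis
      using permutes_not_in[OF assms(1), of j] by (simp add: rank_perm_def)
  qed
qed

lemma rank_perm_cong:
  assumes "\<And>i j. i < n \<Longrightarrow> j < n \<Longrightarrow> H i < H j \<longleftrightarrow> H' i < H' j"
  shows "rank_perm n H = rank_perm n H'"
proof
  show "rank_perm n H j = rank_perm n H' j" for j
    using assms by (cases "j < n") (auto simp: rank_perm_def intro: arg_cong[where f = card])
qed

text \<open>Strict inequalities persist nearby, and there are no ties, so the heights keep their
  order on a neighbourhood of each point.\<close>

lemma continuous_map_rank_perm:
  fixes H :: "nat \<Rightarrow> 'v::topological_space \<Rightarrow> real"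
  assumes cont: "\<And>j. j < n \<Longrightarrow> continuous_on U (H j)"
    and inj: "\<And>z. z \<in> U \<Longrightarrow> inj_on (\<lambda>j. H j z) {..<n}"
  shows "continuous_map (top_of_set U) (discrete_topology (sym_perms n))
    (\<lambda>z. rank_perm n (\<lambda>j. H j z))"
  unfolding continuous_map_def
proof (intro conjI allI impI)
  let ?t = "\<lambda>z. rank_perm n (\<lambda>j. H j z)"
  have "openin (top_of_set U) {z \<in> U. ?t z = g}" for g
  proof (subst openin_subopen, intro ballI)
    fix z assume z: "z \<in> {z \<in> U. ?t z = g}"
    define A where "A = {(i, j). i < n \<and> j < n \<and> H i z < H j z}"
    define W where "W = U \<inter> (\<Inter>(i, j)\<in>A. {w \<in> U. H i w < H j w})"
    have "finite A"
      by (rule finite_subset[of _ "{..<n} \<times> {..<n}"]) (auto simp: A_def)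
    moreover have "openin (top_of_set U) {w \<in> U. H i w < H j w}" if "(i, j) \<in> A" for i j
    proof -
      have "continuous_on U (\<lambda>w. H j w - H i w)"
        using that by (intro continuous_intros cont) (auto simp: A_def)
      then have "openin (top_of_set U) (U \<inter> (\<lambda>w. H j w - H i w) -` {0<..})"
        by (rule continuous_openin_preimage_gen) simp
      moreover have "U \<inter> (\<lambda>w. H j w - H i w) -` {0<..} = {w \<in> U. H i w < H j w}"
        by auto
      ultimately show ?thesis by simp
    qed
    ultimately have "openin (top_of_set U) W"
      unfolding W_def using openin_INT[of A "top_of_set U"] by (auto simp: case_prod_unfold Int_commute)
    moreover have "z \<in> W"
      using z by (auto simp: W_def A_def)
    moreover have "?t w = g" if w: "w \<in> W" for w
    proof -
      have wU: "w \<in> U" and lt: "\<And>i j. i < n \<Longrightarrow> j < n \<Longrightarrow> H i z < H j z \<Longrightarrow> H i w < H j w"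
        using w by (auto simp: W_def A_def)
      have "H i w < H j w \<longleftrightarrow> H i z < H j z" if ij: "i < n" "j < n" for i j
      proof (cases "i = j")
        case False
        then have "H i z \<noteq> H j z"
          using inj_onD[OF inj[of z], of i j] z ij by auto
        then show ?thesis
          using lt[OF ij] lt[OF ij(2,1)] by linarith
      qed simp
      then have "?t w = ?t z"
        by (rule rank_perm_cong)
      with z show ?thesis by simp
    qed
    ultimately show "\<exists>T. openin (top_of_set U) T \<and> z \<in> T \<and> T \<subseteq> {z \<in> U. ?t z = g}"
      by (intro exI[of _ W]) (auto simp: W_def)
  qed
  then have "openin (top_of_set U) (\<Union>g\<in>V. {z \<in> U. ?t z = g})" for V
    by blast
  moreover have "(\<Union>g\<in>V. {z \<in> U. ?t z = g}) = {z \<in> topspace (top_of_set U). ?t z \<in> V}" for V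
    by auto
  ultimately show "openin (top_of_set U) {z \<in> topspace (top_of_set U). ?t z \<in> V}" for V
    by simp
  show "?t \<in> topspace (top_of_set U) \<rightarrow> topspace (discrete_topology (sym_perms n))"
    using rank_perm_permutes[OF inj] by (auto simp: sym_perms_def)
qed

section \<open>Equivariant maps to the group and trivial bundles\<close>

text \<open>Two points of one orbit differ by a group element \<open>g\<close>, and equivariance makes their values
  under \<open>t\<close> differ by the same \<open>g\<close>. So orbit and value determine a point, and within an orbit
  every value is attained exactly once. The inverse is continuous because the orbit map is open:
  the saturation of an open set is the union of its translates.\<close>

lemma trivial_principal_bundleI:
  fixes act :: "'e \<Rightarrow> (nat \<Rightarrow> nat) \<Rightarrow> 'e" and n :: nat
  defines "G \<equiv> sym_perms n"
  defines "p \<equiv> \<lambda>e. act e ` G"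
  assumes act_in: "\<And>e g. e \<in> topspace E \<Longrightarrow> g \<in> G \<Longrightarrow> act e g \<in> topspace E"
    and act_id: "\<And>e. e \<in> topspace E \<Longrightarrow> act e id = e"
    and act_comp: "\<And>e g h. e \<in> topspace E \<Longrightarrow> g \<in> G \<Longrightarrow> h \<in> G \<Longrightarrow> act (act e g) h = act e (g \<circ> h)"
    and act_cont: "\<And>g. g \<in> G \<Longrightarrow> continuous_map E E (\<lambda>e. act e g)"
    and t_cont: "continuous_map E (discrete_topology G) t"
    and t_act: "\<And>e g. e \<in> topspace E \<Longrightarrow> g \<in> G \<Longrightarrow> t (act e g) = t e \<circ> g"
  shows "trivial_principal_bundle G (\<circ>) act E (quotient_topology E p) p"
proof -
  let ?B = "quotient_topology E p"
  have G_id: "id \<in> G" and G_comp: "\<And>g h. g \<in> G \<Longrightarrow> h \<in> G \<Longrightarrow> g \<circ> h \<in> G"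
    and G_inv: "\<And>g. g \<in> G \<Longrightarrow> inv g \<in> G"
    and G_inv_comp: "\<And>g. g \<in> G \<Longrightarrow> inv g \<circ> g = id" "\<And>g. g \<in> G \<Longrightarrow> g \<circ> inv g = id"
    by (auto simp: G_def sym_perms_def permutes_id permutes_compose permutes_inv permutes_inv_o)
  have t_in: "t e \<in> G" if "e \<in> topspace E" for e
    using t_cont that by (auto simp: continuous_map_def)
  have p_act: "p (act e g) = p e" if e: "e \<in> topspace E" and g: "g \<in> G" for e g
  proof -
    have "act e h = act (act e g) (inv g \<circ> h)" if "h \<in> G" for h
      using e g that G_inv_comp(2)[OF g] by (simp add: act_comp G_comp G_inv flip: comp_assoc)
    then have "act e h \<in> p (act e g)" if "h \<in> G" for h
      unfolding p_def using that g G_comp G_inv by blast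
    then have "p e \<subseteq> p (act e g)"
      by (auto simp: p_def)
    moreover have "p (act e g) \<subseteq> p e"
      using e g by (auto simp: p_def act_comp intro!: imageI G_comp)
    ultimately show ?thesis by simp
  qed
  have p_eq: "\<exists>g\<in>G. e' = act e g" if "e' \<in> topspace E" "p e = p e'" for e e'
  proof -
    have "act e' id \<in> p e'"
      unfolding p_def using G_id by (rule imageI)
    then have "e' \<in> p e"
      using that by (simp add: act_id)
    then show ?thesis
      by (auto simp: p_def)
  qed
  have p_open: "openin ?B (p ` U)" if U: "openin E U" for U
  proof -
    have sub: "U \<subseteq> topspace E"
      using U by (rule openin_subset)
    have "{e \<in> topspace E. p e \<in> p ` U} = (\<Union>g\<in>G. {e \<in> topspace E. act e g \<in> U})"
    proof (intro equalityI subsetI)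
      fix e assume "e \<in> {e \<in> topspace E. p e \<in> p ` U}"
      then obtain u where "e \<in> topspace E" "u \<in> U" "p e = p u"
        by blast
      then show "e \<in> (\<Union>g\<in>G. {e \<in> topspace E. act e g \<in> U})"
        using p_eq[of u e] sub by blast
    next
      fix e assume "e \<in> (\<Union>g\<in>G. {e \<in> topspace E. act e g \<in> U})"
      then obtain g where "g \<in> G" "e \<in> topspace E" "act e g \<in> U"
        by blast
      then show "e \<in> {e \<in> topspace E. p e \<in> p ` U}"
        using p_act[of e g] by (metis (mono_tags, lifting) imageI mem_Collect_eq)
    qed
    moreover have "openin E {e \<in> topspace E. act e g \<in> U}" if "g \<in> G" for g
      using act_cont[OF that] U by (rule openin_continuous_map_preimage)
    ultimately show ?thesis
      using sub by (auto simp: openin_quotient_topology)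
  qed
  have p_cont: "continuous_map E ?B p"
    using quotient_map_quotient_topology by (rule quotient_imp_continuous_map)
  let ?\<Phi> = "\<lambda>e. (p e, t e)"
  have "homeomorphic_map E (prod_topology ?B (discrete_topology G)) ?\<Phi>"
  proof (rule bijective_open_imp_homeomorphic_map)
    show "continuous_map E (prod_topology ?B (discrete_topology G)) ?\<Phi>"
      using p_cont t_cont by (simp add: continuous_map_pairedI)
    show "open_map E (prod_topology ?B (discrete_topology G)) ?\<Phi>"
      unfolding open_map_def
    proof (intro allI impI)
      fix U assume U: "openin E U"
      let ?U = "\<lambda>g. U \<inter> {e \<in> topspace E. t e \<in> {g}}"
      have "openin (prod_topology ?B (discrete_topology G)) (p ` ?U g \<times> {g})" if "g \<in> G" for g
      proof -
        have g: "openin (discrete_topology G) {g}"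
          using that by simp
        then have "openin E (?U g)"
          by (rule openin_Int[OF U openin_continuous_map_preimage[OF t_cont]])
        then show ?thesis
          using g by (simp only: openin_prod_Times_iff p_open simp_thms)
      qed
      then have "openin (prod_topology ?B (discrete_topology G)) (\<Union>g\<in>G. p ` ?U g \<times> {g})"
        by (intro openin_Union) blast
      moreover have "?\<Phi> ` U = (\<Union>g\<in>G. p ` ?U g \<times> {g})"
        using openin_subset[OF U] t_in by auto
      ultimately show "openin (prod_topology ?B (discrete_topology G)) (?\<Phi> ` U)"
        by simp
    qed
    show "?\<Phi> ` topspace E = topspace (prod_topology ?B (discrete_topology G))"
    proof -
      have "(p e, g) \<in> ?\<Phi> ` topspace E" if e: "e \<in> topspace E" and g: "g \<in> G" for e g
      proof (rule image_eqI)
        let ?h = "inv (t e) \<circ> g"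
        have h: "?h \<in> G"
          using e g by (simp add: G_comp G_inv t_in)
        then show "act e ?h \<in> topspace E"
          using e by (simp add: act_in)
        have "t e \<circ> ?h = g"
          using G_inv_comp(2)[OF t_in[OF e]] by (simp flip: comp_assoc)
        then show "(p e, g) = (p (act e ?h), t (act e ?h))"
          using e h by (simp add: p_act t_act)
      qed
      then show ?thesis
        using t_in by (auto simp: topspace_quotient_topology)
    qed
    show "inj_on ?\<Phi> (topspace E)"
    proof (rule inj_onI)
      fix e e' assume e: "e \<in> topspace E" "e' \<in> topspace E" "(p e, t e) = (p e', t e')"
      then obtain g where g: "g \<in> G" "e' = act e g"
        using p_eq[of e' e] by auto
      then have "t e = t e \<circ> g"
        using e by (simp add: t_act)
      then have "inv (t e) \<circ> t e = inv (t e) \<circ> t e \<circ> g"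
        by (simp add: comp_assoc)
      then have "g = id"
        using G_inv_comp(1)[OF t_in[OF e(1)]] by simp
      then show "e = e'"
        using g e act_id by simp
    qed
  qed
  then show ?thesis
    unfolding trivial_principal_bundle_def using p_act t_act by blast
qed

section \<open>Maps that lift to an embedding\<close>

lemma lifts_to_embedding_height:
  fixes \<phi> :: "'v::real_normed_vector \<Rightarrow> 'w::real_normed_vector"
  assumes "lifts_to_embedding P Q \<phi>"
  obtains h :: "'v \<Rightarrow> real" where "continuous_on P h" and "inj_on (\<lambda>x. (\<phi> x, h x)) P"
proof -
  obtain \<psi> :: "'v \<Rightarrow> 'w \<times> real" where "pl_embedding_on P \<psi>" and fst: "\<forall>x\<in>P. fst (\<psi> x) = \<phi> x"
    using assms unfolding lifts_to_embedding_def by (elim exE conjE)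
  then obtain k where \<psi>: "homeomorphism P (\<psi> ` P) \<psi> k"
    unfolding pl_embedding_on_def by (elim exE conjE)
  show ?thesis
  proof
    show "continuous_on P (snd \<circ> \<psi>)"
      unfolding comp_def using homeomorphism_cont1[OF \<psi>] by (rule continuous_on_snd)
    have "inj_on \<psi> P"
      using homeomorphism_apply1[OF \<psi>] by (rule inj_on_inverseI)
    moreover have "(\<phi> x, (snd \<circ> \<psi>) x) = \<psi> x" if "x \<in> P" for x
      using fst that by (simp add: prod_eq_iff)
    ultimately show "inj_on (\<lambda>x. (\<phi> x, (snd \<circ> \<psi>) x)) P"
      by (simp cong: inj_on_cong)
  qed
qed

text \<open>The map \<open>t\<close> ranks the coordinates of a point of the tuple complex by their heights.
  Equivariance holds on the nose because \<open>\<pi>\<close> acts on the right: the \<open>j\<close>-th coordinate of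
  \<open>sym_act z \<pi>\<close> is the \<open>\<pi> j\<close>-th coordinate of \<open>z\<close>.\<close>

lemma ranking_of_tuples:
  assumes nondeg: "nondegenerate_simplicial_map K L f"
    and lift: "lifts_to_embedding (realisation K) (realisation L) (realisation_map f)"
  obtains t where "continuous_map (tuple_space K f n) (discrete_topology (sym_perms n)) t"
    and "\<And>z \<pi>. z \<in> realisation (tuple_complex K f n) \<Longrightarrow> \<pi> \<in> sym_perms n \<Longrightarrow>
      t (sym_act z \<pi>) = t z \<circ> \<pi>"
proof -
  obtain h :: "('a \<Rightarrow>\<^sub>0 real) \<Rightarrow> real" where h_cont: "continuous_on (realisation K) h"
    and h_inj: "inj_on (\<lambda>x. (realisation_map f x, h x)) (realisation K)"
    by (rule lifts_to_embedding_height[OF lift])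
  let ?E = "realisation (tuple_complex K f n)"
  define H where "H j z = h (coordinate j z)" for j z
  define t where "t z = rank_perm n (\<lambda>j. H j z)" for z
  show thesis
  proof
    have "inj_on (\<lambda>j. H j z) {..<n}" if z: "z \<in> ?E" for z
    proof (rule inj_onI, rule ccontr)
      fix i j assume ij: "i \<in> {..<n}" "j \<in> {..<n}" "H i z = H j z" "i \<noteq> j"
      then have "coordinate i z = coordinate j z"
        using z by (intro inj_onD[OF h_inj]) (auto simp: H_def intro: coordinate_in realisation_map_coordinate)
      moreover have "coordinate i z \<noteq> coordinate j z"
        using ij z nondegenerate_inj_on_simplex[OF nondeg] by (intro coordinate_distinct[of K f]) auto
      ultimately show False
        by simp
    qed
    moreover have "continuous_on ?E (H j)" if "j < n" for j
      unfolding H_def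
      by (rule continuous_on_compose2[OF h_cont])
        (use that in \<open>auto simp: coordinate_def intro: continuous_on_realisation_map
           coordinate_in[unfolded coordinate_def]\<close>)
    ultimately show "continuous_map (tuple_space K f n) (discrete_topology (sym_perms n)) t"
      unfolding t_def tuple_space_def by (intro continuous_map_rank_perm)
    fix z \<pi> assume "z \<in> ?E" "\<pi> \<in> sym_perms n"
    then show "t (sym_act z \<pi>) = t z \<circ> \<pi>"
      unfolding t_def
      by (intro rank_perm_comp) (auto simp: H_def coordinate_sym_act sym_perms_def)
  qed
qed

lemma lift_imp_trivial_covering:
  assumes "nondegenerate_simplicial_map K L f"
    and "lifts_to_embedding (realisation K) (realisation L) (realisation_map f)"
  shows "trivial_covering K f n"
proof -
  obtain t where t: "continuous_map (tuple_space K f n) (discrete_topology (sym_perms n)) t"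
    "\<And>z \<pi>. z \<in> realisation (tuple_complex K f n) \<Longrightarrow> \<pi> \<in> sym_perms n \<Longrightarrow>
      t (sym_act z \<pi>) = t z \<circ> \<pi>"
    using ranking_of_tuples[OF assms] by blast
  have "orbit_map n = (\<lambda>z :: 'a list \<Rightarrow>\<^sub>0 real. sym_act z ` sym_perms n)"
    by (auto simp: orbit_map_def)
  moreover have "continuous_map (tuple_space K f n) (tuple_space K f n) (\<lambda>z. sym_act z \<pi>)"
    if "\<pi> \<in> sym_perms n" for \<pi>
    using that sym_act_in
    by (auto simp: tuple_space_def sym_act_def intro: continuous_on_realisation_map)
  ultimately show ?thesis
    unfolding trivial_covering_def orbit_space_def
    using trivial_principal_bundleI[of "tuple_space K f n" n sym_act t] t
    by (simp add: tuple_space_def sym_act_in sym_act_id sym_act_comp)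
qed

lemma rotate_eq_permute_list:
  assumes "xs \<noteq> []"
  obtains \<pi> where "\<pi> permutes {..<length xs}" "permute_list \<pi> xs = last xs # butlast xs"
proof -
  have "mset (last xs # butlast xs) = mset (butlast xs @ [last xs])"
    by simp
  also have "\<dots> = mset xs"
    using assms by simp
  finally show thesis
    using that by (rule mset_eq_permutation)
qed

text \<open>The ranking is constant along a path in the tuple complex, whereas passing from a tuple to its rotation composes
  it with the corresponding permutation. So that permutation is the identity and the tuple equals
  its rotation, so that its first and last entries agree. For \<open>n > 1\<close> they are distinct.\<close>

lemma lift_imp_no_obstructor:
  assumes "nondegenerate_simplicial_map K L f"
    and "lifts_to_embedding (realisation K) (realisation L) (realisation_map f)"
    and n: "n > 1"
  shows "\<not> obstructor K f n xs \<gamma>"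
proof
  assume "obstructor K f n xs \<gamma>"
  then have xs: "{xs} \<in> tuple_complex K f n" and \<gamma>: "path \<gamma>"
      "path_image \<gamma> \<subseteq> realisation (tuple_complex K f n)"
      "pathstart \<gamma> = pt xs" "pathfinish \<gamma> = pt (last xs # butlast xs)"
    by (auto simp: obstructor_def)
  have len: "length xs = n" and dist: "distinct xs"
    using xs fibre_tuplesD(1,2)[of xs K f n] by (auto simp: tuple_complex_def)
  obtain t where t: "continuous_map (tuple_space K f n) (discrete_topology (sym_perms n)) t"
    "\<And>z \<pi>. z \<in> realisation (tuple_complex K f n) \<Longrightarrow> \<pi> \<in> sym_perms n \<Longrightarrow>
      t (sym_act z \<pi>) = t z \<circ> \<pi>"
    using ranking_of_tuples[OF assms(1,2)] by blast
  have "xs \<noteq> []"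
    using len n by auto
  then obtain \<pi> where \<pi>: "\<pi> permutes {..<length xs}" "permute_list \<pi> xs = last xs # butlast xs"
    by (rule rotate_eq_permute_list)
  have start: "pt xs \<in> path_image \<gamma>" and finish: "pt (last xs # butlast xs) \<in> path_image \<gamma>"
    using pathstart_in_path_image[of \<gamma>] pathfinish_in_path_image[of \<gamma>] \<gamma> by auto
  have "connectedin (tuple_space K f n) (path_image \<gamma>)"
    using \<gamma>(1,2) by (simp add: tuple_space_def connectedin_subtopology connected_path_image)
  then have "connectedin (discrete_topology (sym_perms n)) (t ` path_image \<gamma>)"
    by (rule connectedin_continuous_map_image[OF t(1)])
  then have "t (pt (last xs # butlast xs)) = t (pt xs)"
    using start finish by (auto simp: connectedin_discrete_topology)
  moreover have "pt (last xs # butlast xs) = sym_act (pt xs) \<pi>"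
    by (simp add: sym_act_def \<pi>(2))
  moreover have "t (sym_act (pt xs) \<pi>) = t (pt xs) \<circ> \<pi>"
    using start \<gamma>(2) \<pi>(1) len by (intro t(2)) (auto simp: sym_perms_def)
  ultimately have fix_t: "t (pt xs) \<circ> \<pi> = t (pt xs)"
    by simp
  have "t (pt xs) permutes {..<n}"
    using t(1) start \<gamma>(2) by (auto simp: continuous_map_def tuple_space_def sym_perms_def)
  then have "\<pi> = id"
    using fix_t permutes_inv_o(2) by (metis comp_assoc id_comp)
  then have rot: "xs = last xs # butlast xs"
    using \<pi>(2) by simp
  then have "xs ! 0 = xs ! (n - 1)"
    using \<open>xs \<noteq> []\<close> len by (metis last_conv_nth nth_Cons_0)
  then show False
    using dist len n by (simp add: nth_eq_iff_index_eq)
qed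

theorem theorem1:
  fixes K :: "'a set set" and L :: "'b set set" and f :: "'a \<Rightarrow> 'b"
  assumes "finite_complex K" and "finite_complex L"
    and "nondegenerate_simplicial_map K L f"
    and "lifts_to_embedding (realisation K) (realisation L) (realisation_map f)"
  shows "(\<forall>n>1. trivial_covering K f n) \<and>
         (\<forall>n>1. \<not> (\<exists>xs \<gamma>. obstructor K f n xs \<gamma>))"
  using lift_imp_trivial_covering[OF assms(3,4)] lift_imp_no_obstructor[OF assms(3,4)] by blast

end
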